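(* Let $d\ge 1$, let $(X_\ell)_{\ell\in\mathbb Z^d}$ be a real random field on a probability space $(\Omega,\mathcal F,\mathbb P)$ whose variables have a common distribution function $F$, and let $\gamma(\ell)$, $\ell\in\mathbb Z^d$, be its mixing coefficients $$\gamma(\ell):=\sup_{r\in\mathbb Z^d}\ \sup_{A\in\sigma(X_r),\,B\in\sigma(X_{\ell+r})}|\mathbb P(A\cap B)-\mathbb P(A)\mathbb P(B)|.$$ Let $(z_k)_{k\ge 0}$ be a sequence in $\mathbb Z^d$ such that its number of self-intersections $V_n$ satisfies $V_n\le C_1\,\dfrac{n^2}{(\log n)^\beta}$ for all $n\ge 2$, for constants $C_1>0$ and $\beta$. Assume that one of the following holds: (i) $\sum_{\ell\in\mathbb Z^d}\gamma(\ell)<+\infty$ and $\beta>1$; (ii) the random field is stationary and, for some $\zeta\in[1,2]$, $\sum_{\ell\in\mathbb Z^d}\gamma(\ell)^\zeta<+\infty$ and $\beta>\zeta$. Then $(X_\ell)$ satisfies a Glivenko-Cantelli theorem along $(z_k)$, i.e. $$\lim_n\ \sup_{s\in\mathbb R}\Big|\frac1n\sum_{k=1}^n \mathbf 1_{(-\infty,s]}(X_{z_k}(\omega))-F(s)\Big|=0\quad\text{for }\mathbb P\text{-a.e. }\omega.$$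
   Context: For a sequence $(z_k)_{k\ge0}$ in $\mathbb Z^d$ and $n\ge1$, $V_n:=\#\{(j,k):0\le j,k\le n-1,\ z_j=z_k\}$. $\sigma(X_\ell)$ denotes the $\sigma$-algebra generated by $X_\ell$. Stationary means strictly stationary: for every $h\in\mathbb Z^d$, $(X_{\ell+h})_\ell$ has the same finite-dimensional distributions as $(X_\ell)_\ell$. *)

theory Defs
  imports "HOL-Probability.Probability"
begin

definition self_intersections :: "(nat \<Rightarrow> int ^ 'd) \<Rightarrow> nat \<Rightarrow> nat" where
  "self_intersections z n = card {(j, k). j < n \<and> k < n \<and> z j = z k}"

abbreviation sigma_of :: "'a measure \<Rightarrow> ('a \<Rightarrow> real) \<Rightarrow> 'a set set" where
  "sigma_of M Y \<equiv> sets (vimage_algebra (space M) Y borel)"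

(* For a probability measure, the suprema below range over nonempty sets of reals
   bounded by 1, so they are genuine suprema. *)
definition mixing_coeff :: "'a measure \<Rightarrow> (int ^ 'd \<Rightarrow> 'a \<Rightarrow> real) \<Rightarrow> int ^ 'd \<Rightarrow> real" where
  "mixing_coeff M X l =
     (SUP r. SUP (A, B) \<in> sigma_of M (X r) \<times> sigma_of M (X (l + r)).
        \<bar>measure M (A \<inter> B) - measure M A * measure M B\<bar>)"

definition stationary_field :: "'a measure \<Rightarrow> (int ^ 'd \<Rightarrow> 'a \<Rightarrow> real) \<Rightarrow> bool" where
  "stationary_field M X \<longleftrightarrow>
     (\<forall>h J. finite J \<longrightarrow>
        distr M (\<Pi>\<^sub>M l\<in>J. borel) (\<lambda>\<omega>. \<lambda>l\<in>J. X (l + h) \<omega>) =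
        distr M (\<Pi>\<^sub>M l\<in>J. borel) (\<lambda>\<omega>. \<lambda>l\<in>J. X l \<omega>))"

end

theory Submission
  imports Defs
begin

text \<open>
  Fix a Borel set \<open>B\<close> and let \<open>S\<^sub>n\<close> be the sum over \<open>k < n\<close> of the centred indicators of
  \<open>X (z k) \<in> B\<close>. Its second moment is at most the double sum of \<open>\<gamma> (z k - z j)\<close> over \<open>j, k < n\<close>.
  For nonnegative summable \<open>g\<close>, the double sum of \<open>g (z k - z j)\<close> is at most \<open>V\<^sub>n\<close> times the total
  mass of \<open>g\<close>, because a product of two occupation numbers is at most the mean of their squares.
  Applying this to \<open>g = \<gamma> powr \<zeta>\<close> after \<open>\<gamma> \<le> t + t powr (1 - \<zeta>) * \<gamma> powr \<zeta>\<close>, with the optimal threshold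
  \<open>t = ln n powr - (\<beta> / \<zeta>)\<close>, makes the second moment of \<open>S\<^sub>n / n\<close> of order \<open>ln n powr - (\<beta> / \<zeta>)\<close>.
  This is summable along \<open>n = \<lceil>\<alpha> ^ i\<rceil>\<close> for every \<open>\<alpha> > 1\<close>, and letting \<open>\<alpha>\<close> tend to \<open>1\<close> fills the gaps.
  Uniformity in \<open>s\<close> then follows from convergence on the open and closed half-lines ending at
  the rational quantiles of \<open>F\<close>.
\<close>

section \<open>Self-intersections and double sums over differences\<close>

lemma sum_differences_le_self_intersections:
  fixes g :: "int ^ 'd \<Rightarrow> real" and z :: "nat \<Rightarrow> int ^ 'd"
  assumes g: "g summable_on UNIV" and g0: "\<And>l. g l \<ge> 0"
  shows "(\<Sum>j<n. \<Sum>k<n. g (z k - z j)) \<le> infsum g UNIV * real (self_intersections z n)"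
proof -
  define c where "c a = real (card {k \<in> {..<n}. z k = a})" for a
  define R where "R = z ` {..<n}"
  have fin: "finite R" by (simp add: R_def)
  have fibre: "(\<Sum>k<n. f (z k)) = (\<Sum>a\<in>R. c a * f a)" for f :: "int ^ 'd \<Rightarrow> real"
    unfolding R_def by (subst sum.image_gen[where g = z]) (auto simp: c_def intro!: sum.cong)
  \<comment> \<open>Any injective reindexing is allowed, so this serves \<open>b - a\<close> both as
    a function of \<open>b\<close> and as a function of \<open>a\<close>, once for each half of the
    split square.\<close>
  have part: "(\<Sum>l\<in>L. g (h l)) \<le> infsum g UNIV" if "inj_on h L" "finite L" for h :: "int ^ 'd \<Rightarrow> _" and L
  proof -
    have "(\<Sum>l\<in>L. g (h l)) = sum g (h ` L)"
      using that(1) by (simp add: sum.reindex)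
    also have "\<dots> \<le> infsum g UNIV"
      using that(2) by (intro finite_sum_le_infsum g g0) auto
    finally show ?thesis .
  qed
  \<comment> \<open>For fixed \<open>j\<close> there are \<open>c (z j)\<close> matching
    \<open>k\<close>; grouping the sum over \<open>j\<close> by sites weights each
    \<open>c a\<close> by \<open>c a\<close> once more, hence the square.\<close>
  have V: "(\<Sum>a\<in>R. (c a)\<^sup>2) = real (self_intersections z n)"
  proof -
    have "{(j, k). j < n \<and> k < n \<and> z j = z k} = (SIGMA j:{..<n}. {k \<in> {..<n}. z k = z j})"
      by auto
    then have "real (self_intersections z n) = (\<Sum>j<n. c (z j))"
      by (simp add: self_intersections_def c_def)
    then show ?thesis
      using fibre[of c] by (simp add: power2_eq_square)
  qed
  have "(\<Sum>j<n. \<Sum>k<n. g (z k - z j)) = (\<Sum>j<n. \<Sum>b\<in>R. c b * g (b - z j))"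
    by (intro sum.cong refl fibre)
  also have "\<dots> = (\<Sum>a\<in>R. c a * (\<Sum>b\<in>R. c b * g (b - a)))"
    by (rule fibre)
  also have "\<dots> = (\<Sum>a\<in>R. \<Sum>b\<in>R. (c a * c b) * g (b - a))"
    by (simp add: sum_distrib_left mult.assoc)
  also have "\<dots> \<le> (\<Sum>a\<in>R. \<Sum>b\<in>R. ((c a)\<^sup>2 / 2 + (c b)\<^sup>2 / 2) * g (b - a))"
  proof (intro sum_mono mult_right_mono g0)
    fix a b
    show "c a * c b \<le> (c a)\<^sup>2 / 2 + (c b)\<^sup>2 / 2"
      using sum_squares_bound[of "c a" "c b"] by simp
  qed
  also have "\<dots> = (\<Sum>a\<in>R. (c a)\<^sup>2 / 2 * (\<Sum>b\<in>R. g (b - a)))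
      + (\<Sum>b\<in>R. (c b)\<^sup>2 / 2 * (\<Sum>a\<in>R. g (b - a)))"
    by (simp add: distrib_right sum.distrib sum_distrib_left)
       (rule sum.swap)
  also have "\<dots> \<le> (\<Sum>a\<in>R. (c a)\<^sup>2 / 2 * infsum g UNIV) + (\<Sum>b\<in>R. (c b)\<^sup>2 / 2 * infsum g UNIV)"
    by (intro add_mono sum_mono mult_left_mono part fin) (auto simp: inj_on_def)
  also have "\<dots> = infsum g UNIV * (\<Sum>a\<in>R. (c a)\<^sup>2)"
    by (simp add: sum_distrib_right[symmetric] sum_divide_distrib[symmetric])
  finally show ?thesis by (simp add: V)
qed

text \<open>Above the threshold, write \<open>x\<close> as
  \<open>x powr (1 - \<zeta>) * x powr \<zeta>\<close>; the first exponent is nonpositive, so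
  replacing \<open>x\<close> by the smaller \<open>t\<close> there only increases the
  product.\<close>

lemma le_threshold_add_powr:
  fixes x t \<zeta> :: real
  assumes "x \<ge> 0" "t > 0" "\<zeta> \<ge> 1"
  shows "x \<le> t + t powr (1 - \<zeta>) * x powr \<zeta>"
proof (cases "x \<le> t")
  case False
  then have "x = x powr (1 - \<zeta>) * x powr \<zeta>"
    using assms by (simp add: powr_add[symmetric])
  also have "\<dots> \<le> t powr (1 - \<zeta>) * x powr \<zeta>"
    using False assms by (intro mult_right_mono powr_mono2') auto
  finally show ?thesis using assms by simp
qed (use assms in \<open>simp add: add_increasing2\<close>)

lemma sum_mixing_le:
  fixes g :: "int ^ 'd \<Rightarrow> real" and z :: "nat \<Rightarrow> int ^ 'd"
  assumes g: "(\<lambda>l. g l powr \<zeta>) summable_on UNIV" and g0: "\<And>l. g l \<ge> 0" and \<zeta>: "\<zeta> \<ge> 1"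
    and n: "n \<ge> 2"
    and V: "real (self_intersections z n) \<le> C * (real n ^ 2 / ln (real n) powr \<beta>)"
  shows "(\<Sum>j<n. \<Sum>k<n. g (z k - z j))
    \<le> (1 + C * infsum (\<lambda>l. g l powr \<zeta>) UNIV) * (real n)\<^sup>2 * ln (real n) powr - (\<beta> / \<zeta>)"
proof -
  define t where "t = ln (real n) powr - (\<beta> / \<zeta>)"
  define G where "G = infsum (\<lambda>l. g l powr \<zeta>) UNIV"
  have ln: "ln (real n) > 0" using n by simp
  have t: "t > 0" unfolding t_def using ln by simp
  \<comment> \<open>The threshold solves \<open>t powr \<zeta> = ln (real n) powr - \<beta>\<close>,
    so the truncation error and the remaining term have the same order.\<close>
  have tp: "t powr (1 - \<zeta>) * ln (real n) powr - \<beta> = t"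
    unfolding t_def powr_powr powr_add[symmetric] using \<zeta> by (simp add: field_simps)
  have G: "G \<ge> 0" unfolding G_def by (intro infsum_nonneg) simp
  have "(\<Sum>j<n. \<Sum>k<n. g (z k - z j))
      \<le> (\<Sum>j<n. \<Sum>k<n. t + t powr (1 - \<zeta>) * g (z k - z j) powr \<zeta>)"
    by (intro sum_mono le_threshold_add_powr g0 t \<zeta>)
  also have "\<dots> = (real n)\<^sup>2 * t + t powr (1 - \<zeta>) * (\<Sum>j<n. \<Sum>k<n. g (z k - z j) powr \<zeta>)"
    by (simp add: sum.distrib sum_distrib_left power2_eq_square)
  also have "\<dots> \<le> (real n)\<^sup>2 * t + t powr (1 - \<zeta>) * (G * real (self_intersections z n))"
    unfolding G_def by (intro add_left_mono mult_left_mono sum_differences_le_self_intersections g) auto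
  also have "\<dots> \<le> (real n)\<^sup>2 * t + t powr (1 - \<zeta>) * (G * (C * (real n ^ 2 / ln (real n) powr \<beta>)))"
    by (intro add_left_mono mult_left_mono V G) auto
  also have "\<dots> = (real n)\<^sup>2 * t + G * C * (real n)\<^sup>2 * (t powr (1 - \<zeta>) * ln (real n) powr - \<beta>)"
    by (simp add: powr_minus field_simps)
  also have "\<dots> = (1 + C * G) * (real n)\<^sup>2 * t"
    unfolding tp by (simp add: algebra_simps)
  finally show ?thesis unfolding t_def G_def .
qed

section \<open>Covariances of events and the mixing coefficient\<close>

text \<open>This bounds the families inside \<open>mixing_coeff\<close> from above, as is required
  to compare their members with a real supremum.\<close>

lemma (in prob_space) abs_covariance_le_1:
  "\<bar>prob (A \<inter> B) - prob A * prob B\<bar> \<le> 1"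
proof -
  have "0 \<le> prob A * prob B" "prob A * prob B \<le> 1"
    by (auto intro: mult_le_one)
  moreover have "0 \<le> prob (A \<inter> B)" "prob (A \<inter> B) \<le> 1" by auto
  ultimately show ?thesis by linarith
qed

text \<open>In the outer supremum for the difference \<open>s - r\<close>, the base point
  \<open>r\<close> pairs \<open>X r\<close> with \<open>X (s - r + r)\<close>, which is
  \<open>X s\<close>; the pair \<open>(A, B)\<close> is then one competitor.\<close>

lemma (in prob_space) covariance_le_mixing_coeff:
  fixes X :: "int ^ 'd \<Rightarrow> 'a \<Rightarrow> real"
  assumes A: "A \<in> sigma_of M (X r)" and B: "B \<in> sigma_of M (X s)"
  shows "\<bar>prob (A \<inter> B) - prob A * prob B\<bar> \<le> mixing_coeff M X (s - r)"
proof -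
  define S where "S q = sigma_of M (X q) \<times> sigma_of M (X (s - r + q))" for q
  define f where "f = (\<lambda>(A, B). \<bar>prob (A \<inter> B) - prob A * prob B\<bar>)"
  have f1: "f p \<le> 1" for p
    unfolding f_def by (cases p) (simp add: abs_covariance_le_1)
  have ne: "S q \<noteq> {}" for q
    unfolding S_def using sets.empty_sets by blast
  have "\<bar>prob (A \<inter> B) - prob A * prob B\<bar> = f (A, B)"
    by (simp add: f_def)
  also have "\<dots> \<le> (SUP p\<in>S r. f p)"
    using A B by (intro cSUP_upper bdd_aboveI[of _ 1]) (auto simp: S_def f1)
  also have "\<dots> \<le> (SUP q. SUP p\<in>S q. f p)"
    by (intro cSUP_upper bdd_aboveI[of _ 1]) (auto intro!: cSUP_least f1 ne)
  also have "\<dots> = mixing_coeff M X (s - r)"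
    by (simp add: mixing_coeff_def S_def f_def)
  finally show ?thesis .
qed

lemma (in prob_space) mixing_coeff_nonneg: "mixing_coeff M X l \<ge> 0"
proof -
  have "\<bar>prob ({} \<inter> {}) - prob {} * prob {}\<bar> \<le> mixing_coeff M X (l - 0)"
    by (rule covariance_le_mixing_coeff) auto
  then show ?thesis by simp
qed

lemma (in prob_space) second_moment_centered_sum:
  fixes A :: "nat \<Rightarrow> 'a set"
  assumes A: "\<And>k. A k \<in> events" and p: "\<And>k. prob (A k) = p"
  shows "expectation (\<lambda>x. (\<Sum>k<n. indicator (A k) x - p)\<^sup>2)
    = (\<Sum>j<n. \<Sum>k<n. prob (A j \<inter> A k) - prob (A j) * prob (A k))"
proof -
  have e: "(indicator (A j) x - p) * (indicator (A k) x - p)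
      = indicator (A j \<inter> A k) x - p * indicator (A j) x - p * indicator (A k) x + p * p" for j k x
    by (simp add: indicator_inter_arith algebra_simps)
  have int: "integrable M (indicator (A j) :: 'a \<Rightarrow> real)"
       "integrable M (indicator (A j \<inter> A k) :: 'a \<Rightarrow> real)" for j k
    using A by (auto intro!: integrable_real_indicator simp: emeasure_eq_measure)
  have "expectation (\<lambda>x. (\<Sum>k<n. indicator (A k) x - p)\<^sup>2)
    = expectation (\<lambda>x. \<Sum>j<n. \<Sum>k<n. (indicator (A j) x - p) * (indicator (A k) x - p))"
    by (simp add: power2_eq_square sum_product)
  also have "\<dots> = (\<Sum>j<n. \<Sum>k<n. expectation (\<lambda>x. (indicator (A j) x - p) * (indicator (A k) x - p)))"
    unfolding e using int by simp
  also have "\<dots> = (\<Sum>j<n. \<Sum>k<n. prob (A j \<inter> A k) - prob (A j) * prob (A k))"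
  proof (intro sum.cong refl)
    fix j k
    show "expectation (\<lambda>x. (indicator (A j) x - p) * (indicator (A k) x - p))
      = prob (A j \<inter> A k) - prob (A j) * prob (A k)"
      unfolding e using int A by (simp add: p prob_space)
  qed
  finally show ?thesis .
qed

section \<open>Almost sure convergence from second moments\<close>

text \<open>The series of the \<open>f i\<close> has finite integral, so it converges almost
  everywhere and its terms tend to 0. This takes the place of Chebyshev and Borel-Cantelli.\<close>

lemma AE_tendsto_0_of_summable_integral:
  fixes f :: "nat \<Rightarrow> 'a \<Rightarrow> real"
  assumes f: "\<And>i. integrable M (f i)" and f0: "\<And>i x. f i x \<ge> 0"
    and s: "summable (\<lambda>i. integral\<^sup>L M (f i))"
  shows "AE x in M. (\<lambda>i. f i x) \<longlonglongrightarrow> 0"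
proof -
  have "(\<integral>\<^sup>+x. (\<Sum>i. ennreal (f i x)) \<partial>M) = (\<Sum>i. \<integral>\<^sup>+x. ennreal (f i x) \<partial>M)"
    using f by (intro nn_integral_suminf) auto
  also have "\<dots> = (\<Sum>i. ennreal (integral\<^sup>L M (f i)))"
    using f f0 by (simp add: nn_integral_eq_integral)
  also have "\<dots> = ennreal (\<Sum>i. integral\<^sup>L M (f i))"
    using f0 s by (intro suminf_ennreal2) auto
  finally have "(\<integral>\<^sup>+x. (\<Sum>i. ennreal (f i x)) \<partial>M) \<noteq> \<infinity>" by simp
  then have "AE x in M. (\<Sum>i. ennreal (f i x)) \<noteq> \<infinity>"
    using f by (intro nn_integral_PInf_AE) auto
  then show ?thesis
  proof eventually_elim
    case (elim x)
    then have "summable (\<lambda>i. f i x)"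
      using f0 by (intro summable_suminf_not_top) auto
    then show ?case by (rule summable_LIMSEQ_zero)
  qed
qed

lemma nat_ceiling_power_bracket:
  fixes \<alpha> :: real
  assumes \<alpha>: "\<alpha> > 1" and n: "n \<ge> 1"
  obtains i where "nat \<lceil>\<alpha> ^ i\<rceil> \<le> n" "n < nat \<lceil>\<alpha> ^ Suc i\<rceil>"
proof -
  define i where "i = nat \<lfloor>log \<alpha> (real n)\<rfloor>"
  have "log \<alpha> (real n) \<ge> 0" using \<alpha> n by simp
  then have "real i \<le> log \<alpha> (real n)" "log \<alpha> (real n) < real (Suc i)"
    unfolding i_def by linarith+
  then have "\<alpha> powr real i \<le> real n" "real n < \<alpha> powr real (Suc i)"
    using \<alpha> n by (simp_all add: le_log_iff log_less_iff)
  then have "\<alpha> ^ i \<le> real n" "real n < \<alpha> ^ Suc i"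
    using \<alpha> by (simp_all only: powr_realpow)
  \<comment> \<open>Since \<open>n\<close> is an integer, rounding the powers up preserves both
    inequalities.\<close>
  then have "nat \<lceil>\<alpha> ^ i\<rceil> \<le> n" "n < nat \<lceil>\<alpha> ^ Suc i\<rceil>"
    by (linarith)+
  then show thesis by (rule that)
qed

text \<open>Between consecutive subsequence times the sum moves by at most the gap, which relative
  to the earlier time is about the ratio minus 1; ratios close to 1 make this small.\<close>

lemma average_tendsto_0_interpolation:
  fixes S :: "nat \<Rightarrow> real"
  assumes lip: "\<And>m n. m \<le> n \<Longrightarrow> \<bar>S n - S m\<bar> \<le> real (n - m)"
    and sub: "\<And>N. (\<lambda>i. S (nat \<lceil>(1 + 1 / real (Suc N)) ^ i\<rceil>) / real (nat \<lceil>(1 + 1 / real (Suc N)) ^ i\<rceil>)) \<longlonglongrightarrow> 0"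
  shows "(\<lambda>n. S n / real n) \<longlonglongrightarrow> 0"
proof (rule LIMSEQ_I)
  fix e :: real assume e: "e > 0"
  obtain N where N: "inverse (real (Suc N)) < e / 3"
    using e reals_Archimedean[of "e / 3"] by auto
  define \<alpha> where "\<alpha> = 1 + 1 / real (Suc N)"
  define m where "m i = nat \<lceil>\<alpha> ^ i\<rceil>" for i
  have \<alpha>: "\<alpha> > 1" "\<alpha> < 1 + e / 3"
    using N by (auto simp: \<alpha>_def inverse_eq_divide)
  have m_ge: "real (m i) \<ge> \<alpha> ^ i" for i unfolding m_def by linarith
  have pow1: "\<alpha> ^ i \<ge> 1" for i using \<alpha> by simp
  have m_le: "real (m i) \<le> \<alpha> ^ i + 1" for i unfolding m_def using pow1[of i] by linarith
  have "(\<lambda>i. S (m i) / real (m i)) \<longlonglongrightarrow> 0"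
    using sub[of N] unfolding m_def \<alpha>_def .
  then have "\<forall>\<^sub>F i in sequentially. \<bar>S (m i) / real (m i)\<bar> < e / 3"
    using e by (intro order_tendstoD(2)[OF tendsto_rabs_zero]) auto
  \<comment> \<open>This controls the rounding error, at most 1, relative to
    \<open>\<alpha> ^ i\<close>.\<close>
  moreover have "(\<lambda>i. (1 / \<alpha>) ^ i) \<longlonglongrightarrow> 0"
    using \<alpha> by (intro LIMSEQ_realpow_zero) auto
  then have "\<forall>\<^sub>F i in sequentially. (1 / \<alpha>) ^ i < e / 3"
    using e by (intro order_tendstoD) auto
  ultimately have "\<forall>\<^sub>F i in sequentially. \<bar>S (m i) / real (m i)\<bar> < e / 3 \<and> (1 / \<alpha>) ^ i < e / 3"
    by (rule eventually_conj)
  then obtain I where I: "\<And>i. i \<ge> I \<Longrightarrow> \<bar>S (m i) / real (m i)\<bar> < e / 3 \<and> (1 / \<alpha>) ^ i < e / 3"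
    by (auto simp: eventually_sequentially)
  show "\<exists>no. \<forall>n\<ge>no. norm (S n / real n - 0) < e"
  proof (intro exI[of _ "m I"] allI impI)
    fix n assume n: "n \<ge> m I"
    have mpos: "real (m i) > 0" for i using m_ge[of i] pow1[of i] by linarith
    then have "n \<ge> 1" using n by (metis less_one linorder_not_le of_nat_0_less_iff order.trans not_less)
    then obtain i where i: "m i \<le> n" "n < m (Suc i)"
      using nat_ceiling_power_bracket[OF \<alpha>(1), of n] unfolding m_def by metis
    have "i \<ge> I"
    proof (rule ccontr)
      assume "\<not> I \<le> i"
      then have "\<alpha> ^ Suc i \<le> \<alpha> ^ I" using \<alpha> by (intro power_increasing) auto
      then have "m (Suc i) \<le> m I" unfolding m_def by (intro nat_mono ceiling_mono)
      then show False using i n by simp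
    qed
    \<comment> \<open>One third of \<open>e\<close> pays for the ratio and one for the rounding; the
      last is left for the average at \<open>m i\<close>.\<close>
    have le: "real (n - m i) \<le> real (m i) * (2 * e / 3)"
    proof -
      have "real (n - m i) \<le> real (m (Suc i)) - real (m i)" using i by simp
      also have "\<dots> \<le> \<alpha> ^ Suc i + 1 - \<alpha> ^ i" using m_le[of "Suc i"] m_ge[of i] by linarith
      also have "\<dots> = \<alpha> ^ i * ((\<alpha> - 1) + (1 / \<alpha>) ^ i)"
        using \<alpha> by (simp add: field_simps power_divide)
      also have "\<dots> \<le> \<alpha> ^ i * (e / 3 + e / 3)"
        using \<alpha> I[OF \<open>i \<ge> I\<close>] by (intro mult_left_mono add_mono) auto
      also have "\<dots> \<le> real (m i) * (e / 3 + e / 3)"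
        using m_ge e by (intro mult_right_mono) auto
      finally show ?thesis by simp
    qed
    have "\<bar>S n\<bar> \<le> \<bar>S (m i)\<bar> + real (n - m i)"
      using lip[OF i(1)] by linarith
    also have "\<dots> < real (m i) * (e / 3) + real (m i) * (2 * e / 3)"
      using I[OF \<open>i \<ge> I\<close>] mpos[of i] le by (intro add_less_le_mono) (auto simp: field_simps)
    also have "\<dots> = real (m i) * e" by (simp add: field_simps)
    also have "\<dots> \<le> real n * e" using i e by simp
    finally show "norm (S n / real n - 0) < e"
      using \<open>n \<ge> 1\<close> by (simp add: field_simps)
  qed
qed

text \<open>At time \<open>\<lceil>\<alpha> ^ i\<rceil>\<close> the logarithm is at least
  \<open>i * ln \<alpha>\<close>, so the second moment of the average is of order
  \<open>i powr - b\<close>, summable because \<open>b > 1\<close>.\<close>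

lemma (in prob_space) AE_average_tendsto_0:
  fixes Y :: "nat \<Rightarrow> 'a \<Rightarrow> real"
  assumes Y: "\<And>k. Y k \<in> borel_measurable M" and Y1: "\<And>k x. \<bar>Y k x\<bar> \<le> 1"
    and mom: "\<And>n. n \<ge> 2 \<Longrightarrow>
      expectation (\<lambda>x. (\<Sum>k<n. Y k x)\<^sup>2) \<le> C * (real n)\<^sup>2 * ln (real n) powr - b"
    and b: "b > 1"
  shows "AE x in M. (\<lambda>n. (\<Sum>k<n. Y k x) / real n) \<longlonglongrightarrow> 0"
proof -
  define S where "S n x = (\<Sum>k<n. Y k x)" for n x
  have S: "S n \<in> borel_measurable M" for n unfolding S_def using Y by measurable
  have lip: "\<bar>S n x - S m x\<bar> \<le> real (n - m)" if "m \<le> n" for m n x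
  proof -
    have "S n x - S m x = (\<Sum>k=m..<n. Y k x)"
      unfolding S_def lessThan_atLeast0 using that by (intro sum_diff_nat_ivl) auto
    also have "\<bar>\<dots>\<bar> \<le> (\<Sum>k=m..<n. \<bar>Y k x\<bar>)" by (rule sum_abs)
    also have "\<dots> \<le> (\<Sum>k=m..<n. 1)" by (intro sum_mono Y1)
    finally show ?thesis by simp
  qed
  have S_le: "\<bar>S n x\<bar> \<le> real n" for n x
    using lip[of 0 n x] by (simp add: S_def)
  have "AE x in M. (\<lambda>i. S (m i) x / real (m i)) \<longlonglongrightarrow> 0"
    if \<alpha>: "\<alpha> > 1" and m: "m = (\<lambda>i. nat \<lceil>\<alpha> ^ i\<rceil>)" for \<alpha> :: real and m
  proof -
    define f where "f i x = (S (m i) x / real (m i))\<^sup>2" for i x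
    have m_ge: "real (m i) \<ge> \<alpha> ^ i" for i unfolding m by linarith
    have f_int: "integrable M (f i)" for i
    proof (rule integrable_const_bound[where B = 1])
      show "AE x in M. norm (f i x) \<le> 1"
        using S_le[of "m i"] by (intro AE_I2) (auto simp: f_def power_divide abs_le_square_iff[symmetric] divide_le_eq_1)
      show "f i \<in> borel_measurable M" unfolding f_def using S by measurable
    qed
    \<comment> \<open>At \<open>i = 0\<close> the time is 1, where the moment hypothesis says
      nothing; a single term does not affect summability.\<close>
    have le: "norm (expectation (f i)) \<le> (\<bar>C\<bar> * ln \<alpha> powr - b) * real i powr - b" if "i \<ge> 1" for i
    proof -
      have "\<alpha> ^ i > 1" using \<alpha> that by simp
      then have m2: "m i \<ge> 2" unfolding m by linarith
      have "ln (real (m i)) \<ge> ln (\<alpha> ^ i)"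
        using m_ge[of i] \<open>\<alpha> ^ i > 1\<close> by (intro ln_mono) auto
      then have ln: "ln (real (m i)) \<ge> real i * ln \<alpha>"
        using \<alpha> by (simp add: ln_realpow)
      have pos: "real i * ln \<alpha> > 0" using \<alpha> that by simp
      have "expectation (f i) = expectation (\<lambda>x. (S (m i) x)\<^sup>2) / (real (m i))\<^sup>2"
        by (simp add: f_def[abs_def] power_divide)
      also have "\<dots> \<le> C * ln (real (m i)) powr - b"
        using mom[OF m2] m2 by (simp add: S_def divide_le_eq mult_ac)
      also have "\<dots> \<le> \<bar>C\<bar> * ln (real (m i)) powr - b"
        by (intro mult_right_mono) auto
      also have "\<dots> \<le> \<bar>C\<bar> * (real i * ln \<alpha>) powr - b"
        using pos b by (intro mult_left_mono powr_mono2' ln) auto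
      also have "\<dots> = (\<bar>C\<bar> * ln \<alpha> powr - b) * real i powr - b"
        using \<alpha> by (simp add: powr_mult)
      moreover have "expectation (f i) \<ge> 0" by (intro Bochner_Integration.integral_nonneg) (simp add: f_def)
      ultimately show ?thesis by simp
    qed
    have "summable (\<lambda>i. expectation (f i))"
      using b by (intro summable_comparison_test'[OF _ le] summable_mult)
        (auto simp: summable_real_powr_iff)
    then have "AE x in M. (\<lambda>i. f i x) \<longlonglongrightarrow> 0"
      by (intro AE_tendsto_0_of_summable_integral f_int) (simp add: f_def)
    then show ?thesis
      by eventually_elim (simp add: f_def power_tendsto_0_iff)
  qed
  \<comment> \<open>The ratios \<open>1 + 1 / real (Suc N)\<close> form a countable family
    accumulating at 1, so one null set serves them all.\<close>
  then have "AE x in M. \<forall>N. (\<lambda>i. S (nat \<lceil>(1 + 1 / real (Suc N)) ^ i\<rceil>) x / real (nat \<lceil>(1 + 1 / real (Suc N)) ^ i\<rceil>)) \<longlonglongrightarrow> 0"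
    unfolding AE_all_countable by auto
  then show ?thesis
  proof eventually_elim
    case (elim x)
    then have "(\<lambda>n. S n x / real n) \<longlonglongrightarrow> 0"
      by (intro average_tendsto_0_interpolation lip) auto
    then show ?case by (simp add: S_def)
  qed
qed


section \<open>Strong law along the sequence\<close>

text \<open>Passes from indices below \<open>n\<close> to indices from 1 to \<open>n\<close>: the
  average of \<open>Suc n\<close> centred terms is rescaled, and dropping \<open>a 0\<close> costs
  order \<open>1 / n\<close>.\<close>

lemma average_shift_tendsto:
  fixes a :: "nat \<Rightarrow> real"
  assumes "(\<lambda>n. (\<Sum>k<n. a k - p) / real n) \<longlonglongrightarrow> 0"
  shows "(\<lambda>n. 1 / real n * (\<Sum>k=1..n. a k)) \<longlonglongrightarrow> p"
proof -
  define u where "u n = (\<Sum>k<n. a k - p) / real n" for n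
  have "(\<lambda>n. u (Suc n) * (1 + 1 / real n) + (p - a 0) * (1 / real n) + p) \<longlonglongrightarrow> 0 * (1 + 0) + (p - a 0) * 0 + p"
    by (intro tendsto_intros LIMSEQ_Suc lim_1_over_n) (use assms in \<open>simp add: u_def\<close>)
  moreover have "\<forall>\<^sub>F n in sequentially.
      u (Suc n) * (1 + 1 / real n) + (p - a 0) * (1 / real n) + p = 1 / real n * (\<Sum>k=1..n. a k)"
    using eventually_gt_at_top[of 0]
  proof eventually_elim
    case (elim n)
    have "(\<Sum>k=1..n. a k) = (\<Sum>k<Suc n. a k) - a 0"
      by (simp add: lessThan_Suc_atMost sum.atLeast_Suc_atMost atMost_atLeast0)
    moreover have "1 + 1 / real n = real (Suc n) / real n"
      using elim by (simp add: field_simps)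
    then have "u (Suc n) * (1 + 1 / real n) = (\<Sum>k<Suc n. a k - p) / real n"
      by (simp add: u_def del: sum.lessThan_Suc of_nat_Suc)
    moreover have "(\<Sum>k<Suc n. a k - p) = (\<Sum>k<Suc n. a k) - real (Suc n) * p"
      by (simp add: sum_subtractf del: sum.lessThan_Suc)
    moreover have "(T - real (Suc n) * p) / real n + (p - a 0) * (1 / real n) + p = 1 / real n * (T - a 0)" for T
      using elim by (simp add: field_simps)
    ultimately show ?case by (simp only:)
  qed
  ultimately show ?thesis by (simp add: Lim_transform_eventually)
qed

text \<open>The second moment of the centred averages decays with exponent
  \<open>\<beta> / \<zeta>\<close> in the logarithm, and \<open>\<beta> > \<zeta>\<close> puts this
  exponent above 1.\<close>

lemma (in prob_space) mixing_strong_law_along_sequence: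
  fixes X :: "int ^ 'd \<Rightarrow> 'a \<Rightarrow> real" and z :: "nat \<Rightarrow> int ^ 'd"
  assumes X: "\<And>l. X l \<in> borel_measurable M" and distr: "\<And>l. distr M borel (X l) = \<nu>"
    and V: "\<And>n. n \<ge> 2 \<Longrightarrow> real (self_intersections z n) \<le> C * (real n ^ 2 / ln (real n) powr \<beta>)"
    and mix: "(\<lambda>l. mixing_coeff M X l powr \<zeta>) summable_on UNIV"
    and \<zeta>: "\<zeta> \<ge> 1" "\<beta> > \<zeta>"
    and B: "B \<in> sets borel"
  shows "AE \<omega> in M. (\<lambda>n. 1 / real n * (\<Sum>k=1..n. indicator B (X (z k) \<omega>))) \<longlonglongrightarrow> measure \<nu> B"
proof -
  define A where "A k = X (z k) -` B \<inter> space M" for k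
  define p where "p = measure \<nu> B"
  have A_sigma: "A k \<in> sigma_of M (X (z k))" for k
    unfolding A_def by (rule in_vimage_algebra) fact
  have A: "A k \<in> events" for k
    unfolding A_def using X B by (rule measurable_sets)
  have p: "prob (A k) = p" for k
    unfolding p_def distr[symmetric, of "z k"] A_def using X B by (simp add: measure_distr)
  have p01: "0 \<le> p" "p \<le> 1" unfolding p[of 0, symmetric] by auto
  have "AE \<omega> in M. (\<lambda>n. (\<Sum>k<n. indicator (A k) \<omega> - p) / real n) \<longlonglongrightarrow> 0"
  proof (rule AE_average_tendsto_0)
    show "(\<lambda>\<omega>. indicator (A k) \<omega> - p) \<in> borel_measurable M" for k
      using A[of k] by measurable
    show "\<bar>indicator (A k) \<omega> - p\<bar> \<le> 1" for k \<omega>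
      using p01 by (auto simp: indicator_def)
    show "\<beta> / \<zeta> > 1" using \<zeta> by simp
  next
    fix n :: nat assume n: "n \<ge> 2"
    have "expectation (\<lambda>\<omega>. (\<Sum>k<n. indicator (A k) \<omega> - p)\<^sup>2)
        = (\<Sum>j<n. \<Sum>k<n. prob (A j \<inter> A k) - prob (A j) * prob (A k))"
      by (intro second_moment_centered_sum A p)
    also have "\<dots> \<le> (\<Sum>j<n. \<Sum>k<n. mixing_coeff M X (z k - z j))"
      by (intro sum_mono abs_le_D1[OF covariance_le_mixing_coeff] A_sigma)
    also have "\<dots> \<le> (1 + C * infsum (\<lambda>l. mixing_coeff M X l powr \<zeta>) UNIV) * (real n)\<^sup>2 * ln (real n) powr - (\<beta> / \<zeta>)"
      by (intro sum_mixing_le mix mixing_coeff_nonneg \<zeta> n V)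
    finally show "expectation (\<lambda>\<omega>. (\<Sum>k<n. indicator (A k) \<omega> - p)\<^sup>2)
        \<le> (1 + C * infsum (\<lambda>l. mixing_coeff M X l powr \<zeta>) UNIV) * (real n)\<^sup>2 * ln (real n) powr - (\<beta> / \<zeta>)" .
  qed
  then have "AE \<omega> in M. (\<lambda>n. 1 / real n * (\<Sum>k=1..n. indicator (A k) \<omega>)) \<longlonglongrightarrow> p"
    by eventually_elim (rule average_shift_tendsto)
  then show ?thesis
    using AE_space
  proof eventually_elim
    case (elim \<omega>)
    have "indicator (A k) \<omega> = (indicator B (X (z k) \<omega>) :: real)" for k
      using elim(2) by (simp add: A_def indicator_def)
    then show ?case using elim(1) by (simp add: p_def)
  qed
qed

section \<open>Empirical measures and quantiles\<close>

text \<open>Taken on arbitrary sets because open half-lines are needed besides the closed ones of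
  the distribution function. At \<open>n = 0\<close> the value is 0.\<close>

definition empirical_measure :: "(nat \<Rightarrow> real) \<Rightarrow> nat \<Rightarrow> real set \<Rightarrow> real" where
  "empirical_measure x n B = 1 / real n * (\<Sum>k=1..n. indicator B (x k))"

lemma empirical_measure_mono: "A \<subseteq> B \<Longrightarrow> empirical_measure x n A \<le> empirical_measure x n B"
  unfolding empirical_measure_def by (intro mult_left_mono sum_mono) (auto simp: indicator_def)

lemma empirical_measure_nonneg: "0 \<le> empirical_measure x n A"
  unfolding empirical_measure_def by (intro mult_nonneg_nonneg sum_nonneg) auto

lemma empirical_measure_le_1: "empirical_measure x n A \<le> 1"
proof -
  have "(\<Sum>k=1..n. indicator A (x k)) \<le> (\<Sum>k=1..n. 1 :: real)"
    by (intro sum_mono) (auto simp: indicator_def)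
  then show ?thesis by (simp add: empirical_measure_def divide_le_eq)
qed

context cdf_distribution
begin

text \<open>\<open>I\<close> is the quantile function: for \<open>p\<close> strictly between 0 and
  1, \<open>p \<le> cdf M y\<close> is equivalent to \<open>I p \<le> y\<close>. Take
  \<open>y = I p\<close>.\<close>

lemma le_prob_atMost_quantile: "0 < p \<Longrightarrow> p < 1 \<Longrightarrow> p \<le> prob {..I p}"
  using pseudoinverse[of p "I p"] by (simp add: cdf_def)

text \<open>Points below \<open>I p\<close> have distribution function below \<open>p\<close>, and
  closed half-lines ending there exhaust the open one. With an atom at \<open>I p\<close> the closed
  half-line may exceed \<open>p\<close>, which is why open ones are tracked.\<close>

lemma prob_lessThan_quantile_le:
  assumes "0 < p" "p < 1"
  shows "prob {..<I p} \<le> p"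
proof (rule LIMSEQ_le_const2)
  show "(\<lambda>n. prob {..I p - 1 / real (Suc n)}) \<longlonglongrightarrow> prob {..<I p}"
  proof -
    have "(\<Union>n. {..I p - 1 / real (Suc n)}) = {..<I p}"
    proof safe
      fix y assume "y < I p"
      then obtain n where "inverse (real (Suc n)) < I p - y"
        using reals_Archimedean[of "I p - y"] by auto
      then show "y \<in> (\<Union>n. {..I p - 1 / real (Suc n)})"
        by (auto simp: inverse_eq_divide intro!: exI[of _ n])
    qed (auto intro: le_less_trans)
    moreover have "(\<lambda>n. prob {..I p - 1 / real (Suc n)}) \<longlonglongrightarrow> prob (\<Union>n. {..I p - 1 / real (Suc n)})"
      by (intro finite_Lim_measure_incseq) (auto simp: incseq_def frac_le intro: order_trans)
    ultimately show ?thesis by simp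
  qed
  have "prob {..I p - 1 / real (Suc n)} \<le> p" for n
    using pseudoinverse[OF assms, of "I p - 1 / real (Suc n)"] by (simp add: cdf_def)
  then show "\<exists>N. \<forall>n\<ge>N. prob {..I p - 1 / real (Suc n)} \<le> p" by blast
qed

text \<open>The value \<open>cdf M s\<close> lies in a cell of mesh \<open>1 / m\<close>, so
  \<open>s\<close> lies between the quantiles at the ends of the cell; monotonicity costs one mesh
  width on top of \<open>\<delta>\<close>.\<close>

lemma empirical_cdf_error_le:
  fixes m :: nat
  assumes m: "m > 0"
    and Q: "\<And>i. 0 < i \<Longrightarrow> i < m \<Longrightarrow>
      \<bar>empirical_measure x n {..I (real i / real m)} - prob {..I (real i / real m)}\<bar> \<le> \<delta> \<and>
      \<bar>empirical_measure x n {..<I (real i / real m)} - prob {..<I (real i / real m)}\<bar> \<le> \<delta>"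
    and \<delta>: "\<delta> \<ge> 0"
  shows "\<bar>empirical_measure x n {..s} - cdf M s\<bar> \<le> 1 / real m + \<delta>"
proof -
  \<comment> \<open>The cap at \<open>m - 1\<close> matters only when \<open>cdf M s = 1\<close>,
    where the floor is \<open>m\<close>.\<close>
  define i where "i = min (nat \<lfloor>real m * cdf M s\<rfloor>) (m - 1)"
  have F01: "0 \<le> cdf M s" "cdf M s \<le> 1" by (simp_all add: cdf_nonneg cdf_bounded_prob)
  then have "0 \<le> real m * cdf M s" "real m * cdf M s \<le> real m"
    using m by (simp_all add: mult_left_le)
  then have "real i \<le> real m * cdf M s" "real m * cdf M s \<le> real (Suc i)"
    "Suc i < m \<Longrightarrow> real m * cdf M s < real (Suc i)"
    unfolding i_def by linarith+
  then have i: "real i / real m \<le> cdf M s" "cdf M s \<le> real (Suc i) / real m"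
    "Suc i < m \<Longrightarrow> cdf M s < real (Suc i) / real m"
    using m by (simp_all add: field_simps)
  have im: "i < m" using m by (simp add: i_def)
  have step: "real (Suc i) / real m = real i / real m + 1 / real m"
    by (simp add: add_divide_distrib)
  have "cdf M s \<le> empirical_measure x n {..s} + (1 / real m + \<delta>)"
  proof (cases "i = 0")
    \<comment> \<open>No quantile is available at level 0, but here
      \<open>cdf M s \<le> 1 / real m\<close> already suffices.\<close>
    case True
    then show ?thesis using i \<delta> empirical_measure_nonneg[of x n "{..s}"] by simp
  next
    case False
    then have p: "0 < real i / real m" "real i / real m < 1" using im by auto
    have "I (real i / real m) \<le> s" using pseudoinverse[OF p, of s] i(1) by blast
    then have "empirical_measure x n {..I (real i / real m)} \<le> empirical_measure x n {..s}"
      by (intro empirical_measure_mono) auto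
    then show ?thesis using Q[of i] False im le_prob_atMost_quantile[OF p] i step by linarith
  qed
  moreover have "empirical_measure x n {..s} \<le> cdf M s + (1 / real m + \<delta>)"
  proof (cases "Suc i < m")
    case True
    then have p: "0 < real (Suc i) / real m" "real (Suc i) / real m < 1" by auto
    \<comment> \<open>The strict upper bound on \<open>cdf M s\<close> keeps \<open>s\<close> off
      the quantile, so the closed half-line at \<open>s\<close> fits inside the open one.\<close>
    have "s < I (real (Suc i) / real m)" using pseudoinverse[OF p, of s] i(3)[OF True] by (meson not_le)
    then have "empirical_measure x n {..s} \<le> empirical_measure x n {..<I (real (Suc i) / real m)}"
      by (intro empirical_measure_mono) auto
    then show ?thesis using Q[of "Suc i"] True prob_lessThan_quantile_le[OF p] i step by linarith
  next
    case False
    \<comment> \<open>In the top cell \<open>cdf M s\<close> is at least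
      \<open>1 - 1 / real m\<close>, while the empirical measure is at most 1.\<close>
    then have "1 \<le> real (Suc i) / real m" using m by (simp add: field_simps)
    then show ?thesis using i step \<delta> empirical_measure_le_1[of x n "{..s}"] by linarith
  qed
  ultimately show ?thesis by linarith
qed

text \<open>For \<open>p\<close> outside \<open>{0<..<1}\<close> the quantile \<open>I p\<close> is a junk value; the hypotheses at such \<open>p\<close> are harmless,
  since they will be verified for half-lines with arbitrary endpoints.\<close>

lemma glivenko_cantelli_of_tendsto_quantiles:
  assumes le: "\<And>p. p \<in> \<rat> \<Longrightarrow> (\<lambda>n. empirical_measure x n {..I p}) \<longlonglongrightarrow> prob {..I p}"
    and less: "\<And>p. p \<in> \<rat> \<Longrightarrow> (\<lambda>n. empirical_measure x n {..<I p}) \<longlonglongrightarrow> prob {..<I p}"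
  shows "(\<lambda>n. SUP s. \<bar>empirical_measure x n {..s} - cdf M s\<bar>) \<longlonglongrightarrow> 0"
proof (rule LIMSEQ_I)
  fix e :: real assume e: "e > 0"
  obtain m' where "inverse (real (Suc m')) < e / 3"
    using e reals_Archimedean[of "e / 3"] by auto
  then obtain m :: nat where m: "m > 0" "1 / real m < e / 3"
    by (metis inverse_eq_divide zero_less_Suc)
  have near: "\<forall>\<^sub>F n in sequentially. \<bar>u n - l\<bar> \<le> e / 3" if "u \<longlonglongrightarrow> l" for u :: "nat \<Rightarrow> real" and l
    using tendstoD[OF that, of "e / 3"] e by (auto simp: dist_real_def elim: eventually_mono)
  have "\<forall>\<^sub>F n in sequentially. \<forall>i\<in>{0<..<m}.
      \<bar>empirical_measure x n {..I (real i / real m)} - prob {..I (real i / real m)}\<bar> \<le> e / 3 \<and>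
      \<bar>empirical_measure x n {..<I (real i / real m)} - prob {..<I (real i / real m)}\<bar> \<le> e / 3"
    by (intro eventually_ball_finite ballI eventually_conj near le less) auto
  then obtain N where Q: "\<forall>n\<ge>N. \<forall>i\<in>{0<..<m}.
      \<bar>empirical_measure x n {..I (real i / real m)} - prob {..I (real i / real m)}\<bar> \<le> e / 3 \<and>
      \<bar>empirical_measure x n {..<I (real i / real m)} - prob {..<I (real i / real m)}\<bar> \<le> e / 3"
    unfolding eventually_sequentially by blast
  have N: "\<bar>empirical_measure x n {..s} - cdf M s\<bar> \<le> 1 / real m + e / 3" if "n \<ge> N" for n s
  proof (rule empirical_cdf_error_le)
    show "\<bar>empirical_measure x n {..I (real i / real m)} - prob {..I (real i / real m)}\<bar> \<le> e / 3 \<and>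
      \<bar>empirical_measure x n {..<I (real i / real m)} - prob {..<I (real i / real m)}\<bar> \<le> e / 3"
      if "0 < i" "i < m" for i
      using Q \<open>n \<ge> N\<close> that by (meson greaterThanLessThan_iff)
  qed (use m e in auto)
  show "\<exists>no. \<forall>n\<ge>no. norm ((SUP s. \<bar>empirical_measure x n {..s} - cdf M s\<bar>) - 0) < e"
  proof (intro exI[of _ N] allI impI)
    fix n assume n: "n \<ge> N"
    let ?f = "\<lambda>s. \<bar>empirical_measure x n {..s} - cdf M s\<bar>"
    have "(SUP s. ?f s) \<le> 1 / real m + e / 3"
      using N[OF n] by (intro cSUP_least) auto
    moreover have "0 \<le> (SUP s. ?f s)"
      using N[OF n] by (intro cSUP_upper2[where x = 0] bdd_aboveI[of _ "1 / real m + e / 3"]) auto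
    ultimately show "norm ((SUP s. ?f s) - 0) < e" using m e by simp
  qed
qed

end

section \<open>Glivenko-Cantelli along the sequence\<close>

theorem theorem1p5:
  fixes M :: "'a measure"
    and X :: "int ^ 'd::finite \<Rightarrow> 'a \<Rightarrow> real"
    and F :: "real \<Rightarrow> real"
    and z :: "nat \<Rightarrow> int ^ 'd"
    and C1 \<beta> :: real
  assumes "prob_space M"
    and "\<And>l. X l \<in> borel_measurable M"
    and "\<And>l. cdf (distr M borel (X l)) = F"
    and "C1 > 0"
    and "\<And>n. n \<ge> 2 \<Longrightarrow> real (self_intersections z n) \<le> C1 * (real n ^ 2 / ln (real n) powr \<beta>)"
    and "(mixing_coeff M X summable_on UNIV \<and> \<beta> > 1) \<or>
         (stationary_field M X \<and>
          (\<exists>\<zeta>\<in>{1..2}. (\<lambda>l. mixing_coeff M X l powr \<zeta>) summable_on UNIV \<and> \<beta> > \<zeta>))"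
  shows "AE \<omega> in M.
           (\<lambda>n. SUP s. \<bar>1 / real n * (\<Sum>k=1..n. indicator {..s} (X (z k) \<omega>)) - F s\<bar>) \<longlonglongrightarrow> 0"
proof -
  interpret prob_space M by fact
  define \<nu> where "\<nu> = distr M borel (X 0)"
  have real_distr: "real_distribution (distr M borel (X l))" for l
    using assms(2) by simp
  then interpret \<nu>: cdf_distribution \<nu>
    unfolding \<nu>_def cdf_distribution_def .
  \<comment> \<open>A law on the real line is determined by its distribution function, so a common
    \<open>F\<close> means a common law.\<close>
  have distr: "distr M borel (X l) = \<nu>" for l
    unfolding \<nu>_def by (intro cdf_unique real_distr) (simp add: assms(3))
  have F: "cdf \<nu> = F" unfolding \<nu>_def by (rule assms(3))
  \<comment> \<open>Summability of the coefficients themselves is the case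
    \<open>\<zeta> = 1\<close>, as \<open>powr 1\<close> fixes nonnegative reals.\<close>
  obtain \<zeta> where \<zeta>: "\<zeta> \<ge> 1" "\<beta> > \<zeta>" and mix: "(\<lambda>l. mixing_coeff M X l powr \<zeta>) summable_on UNIV"
    using assms(6)
  proof (elim disjE conjE bexE)
    assume "mixing_coeff M X summable_on UNIV" "\<beta> > 1"
    then show thesis
      by (intro that[of 1]) (simp_all add: mixing_coeff_nonneg)
  qed (auto intro: that)
  have SLLN: "AE \<omega> in M. (\<lambda>n. empirical_measure (\<lambda>k. X (z k) \<omega>) n B) \<longlonglongrightarrow> measure \<nu> B"
    if "B \<in> sets borel" for B
    unfolding empirical_measure_def
    by (rule mixing_strong_law_along_sequence[OF assms(2) distr assms(5) mix \<zeta> that])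
  \<comment> \<open>All grid levels \<open>i / m\<close> are rational, so a countable union of null
    sets covers every mesh.\<close>
  have "AE \<omega> in M. \<forall>p\<in>\<rat>.
      (\<lambda>n. empirical_measure (\<lambda>k. X (z k) \<omega>) n {..\<nu>.I p}) \<longlonglongrightarrow> measure \<nu> {..\<nu>.I p} \<and>
      (\<lambda>n. empirical_measure (\<lambda>k. X (z k) \<omega>) n {..<\<nu>.I p}) \<longlonglongrightarrow> measure \<nu> {..<\<nu>.I p}"
    by (intro AE_ball_countable' AE_conjI SLLN countable_rat) auto
  then show ?thesis
  proof eventually_elim
    case (elim \<omega>)
    then have "(\<lambda>n. SUP s. \<bar>empirical_measure (\<lambda>k. X (z k) \<omega>) n {..s} - cdf \<nu> s\<bar>) \<longlonglongrightarrow> 0"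
      by (intro \<nu>.glivenko_cantelli_of_tendsto_quantiles) auto
    then show ?case by (simp only: empirical_measure_def F)
  qed
qed

end
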